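(* Let $k\ge 2$ be an integer and let $q\in\mathbb{C}\setminus\{0\}$ satisfy $q^n\neq1$ for all $n\in\mathbb{N}$. Let $\{p_n(x)\}_{n\ge0}$ and $\{q_n(x)\}_{n\ge0}$ be two monic orthogonal polynomial sequences (OPS) satisfying $$p_{nk}(x)=q_n(x^k),\qquad n=0,1,2,\ldots.$$ If $\{p_n(x)\}_{n\ge0}$ is $H_q$-semiclassical of class $s\le k-1$, then $\{q_n(x)\}_{n\ge0}$ is $H_{q^k}$-classical.
   Context: $\mathcal{P}$ is the vector space of polynomials in one variable with complex coefficients, $\mathcal{P}^*$ its algebraic dual, $\langle\mathbf{u},f\rangle$ the action of $\mathbf{u}\in\mathcal{P}^*$ on $f\in\mathcal{P}$; $\mathbb{N}=\{1,2,\ldots\}$. OPS: a sequence $\{p_n\}_{n\ge0}$ in $\mathcal{P}$ is an OPS with respect to $\mathbf{u}\in\mathcal{P}^*$ if $\deg p_n=n$ for all $n\ge 0$ and $\langle\mathbf{u},p_np_m\rangle=k_n\delta_{n,m}$ for all $n,m\ge 0$ with all $k_n\in\mathbb{C}\setminus\{0\}$; in that case $\mathbf{u}$ is called regular. A sequence is an OPS if it is an OPS with respect to some $\mathbf{u}\in\mathcal{P}^*$ (which is then unique up to a nonzero constant factor). For $r\in\mathbb{C}\setminus\{0\}$ with $r^n\ne1$ for all $n\in\mathbb{N}$, the Hahn operator $H_r:\mathcal{P}\to\mathcal{P}$ is $(H_rf)(x)=\frac{f(rx)-f(x)}{(r-1)x}$. On functionals: $\langle H_r\mathbf{u},f\rangle=-\langle\mathbf{u},H_rf\rangle$.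 For $\phi\in\mathcal{P}$, $\phi\mathbf{u}$ is defined by $\langle\phi\mathbf{u},f\rangle=\langle\mathbf{u},\phi f\rangle$. A functional $\mathbf{u}$ is $H_r$-semiclassical if it is regular and there exist nonzero polynomials $\Phi,\Psi$ with $\deg\Psi\ge1$ such that $H_r(\Phi\mathbf{u})=\Psi\mathbf{u}$. Its class is the minimum of $\max\{\deg\Phi-2,\deg\Psi-1\}$ over all such pairs $(\Phi,\Psi)$ (a nonnegative integer). An OPS with respect to an $H_r$-semiclassical functional (of class $s$) is called an $H_r$-semiclassical OPS (of class $s$); when $s=0$ it is called an $H_r$-classical OPS. *)

theory Defs
  imports Complex_Main "HOL-Computational_Algebra.Polynomial"
begin

text \<open>
  An element of the algebraic dual of the space of complex polynomials is a function
  on \<open>complex poly\<close> that is linear with respect to \<^const>\<open>smult\<close>.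
\<close>

definition linear_functional :: "(complex poly \<Rightarrow> complex) \<Rightarrow> bool" where
  "linear_functional u \<longleftrightarrow> Vector_Spaces.linear smult (*) u"

definition poly_times_functional ::
    "complex poly \<Rightarrow> (complex poly \<Rightarrow> complex) \<Rightarrow> (complex poly \<Rightarrow> complex)" where
  "poly_times_functional \<phi> u = (\<lambda>f. u (\<phi> * f))"

definition OPS_wrt :: "(complex poly \<Rightarrow> complex) \<Rightarrow> (nat \<Rightarrow> complex poly) \<Rightarrow> bool" where
  "OPS_wrt u p \<longleftrightarrow>
     linear_functional u \<and> (\<forall>n. degree (p n) = n) \<and>
     (\<exists>\<kappa> :: nat \<Rightarrow> complex. (\<forall>n. \<kappa> n \<noteq> 0) \<and>
        (\<forall>n m. u (p n * p m) = (if n = m then \<kappa> n else 0)))"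

definition OPS :: "(nat \<Rightarrow> complex poly) \<Rightarrow> bool" where
  "OPS p \<longleftrightarrow> (\<exists>u. OPS_wrt u p)"

definition monic_OPS :: "(nat \<Rightarrow> complex poly) \<Rightarrow> bool" where
  "monic_OPS p \<longleftrightarrow> OPS p \<and> (\<forall>n. lead_coeff (p n) = 1)"

definition regular_functional :: "(complex poly \<Rightarrow> complex) \<Rightarrow> bool" where
  "regular_functional u \<longleftrightarrow> (\<exists>p. OPS_wrt u p)"

text \<open>
  The Hahn operator \<open>f \<mapsto> (f(r x) - f(x)) / ((r - 1) x)\<close>. The polynomial division below is
  exact whenever \<open>r \<noteq> 1\<close>, see \<open>hahn_op_mult\<close> and \<open>poly_hahn_op\<close>.
\<close>

definition hahn_op :: "complex \<Rightarrow> complex poly \<Rightarrow> complex poly" where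
  "hahn_op r f = (f \<circ>\<^sub>p [:0, r:] - f) div [:0, r - 1:]"

lemma hahn_op_mult:
  assumes "r \<noteq> 1"
  shows "[:0, r - 1:] * hahn_op r f = f \<circ>\<^sub>p [:0, r:] - f"
proof -
  have "poly (f \<circ>\<^sub>p [:0, r:] - f) 0 = 0"
    by (simp add: poly_pcompose)
  then obtain g where g: "f \<circ>\<^sub>p [:0, r:] - f = [:0, 1:] * g"
    unfolding poly_eq_0_iff_dvd by (auto elim: dvdE)
  have "f \<circ>\<^sub>p [:0, r:] - f = [:0, r - 1:] * smult (inverse (r - 1)) g"
    using assms by (simp add: g)
  then have "[:0, r - 1:] dvd f \<circ>\<^sub>p [:0, r:] - f"
    by (rule dvdI)
  then show ?thesis
    unfolding hahn_op_def by (rule dvd_mult_div_cancel)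
qed

lemma poly_hahn_op:
  assumes "r \<noteq> 1" and "x \<noteq> 0"
  shows "poly (hahn_op r f) x = (poly f (r * x) - poly f x) / ((r - 1) * x)"
proof -
  have "poly ([:0, r - 1:] * hahn_op r f) x = poly f (r * x) - poly f x"
    unfolding hahn_op_mult[OF assms(1)] by (simp add: poly_pcompose mult.commute)
  then show ?thesis
    using assms by (simp add: field_simps)
qed

definition hahn_functional ::
    "complex \<Rightarrow> (complex poly \<Rightarrow> complex) \<Rightarrow> (complex poly \<Rightarrow> complex)" where
  "hahn_functional r u = (\<lambda>f. - u (hahn_op r f))"

definition hahn_pair ::
    "complex \<Rightarrow> (complex poly \<Rightarrow> complex) \<Rightarrow> complex poly \<Rightarrow> complex poly \<Rightarrow> bool" where
  "hahn_pair r u \<Phi> \<Psi> \<longleftrightarrow>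
     \<Phi> \<noteq> 0 \<and> \<Psi> \<noteq> 0 \<and> degree \<Psi> \<ge> 1 \<and>
     hahn_functional r (poly_times_functional \<Phi> u) = poly_times_functional \<Psi> u"

definition hahn_semiclassical :: "complex \<Rightarrow> (complex poly \<Rightarrow> complex) \<Rightarrow> bool" where
  "hahn_semiclassical r u \<longleftrightarrow> regular_functional u \<and> (\<exists>\<Phi> \<Psi>. hahn_pair r u \<Phi> \<Psi>)"

text \<open>
  Since \<open>degree \<Psi> \<ge> 1\<close>, the second entry of the maximum is a nonnegative integer, so truncated
  subtraction in the first entry does not change the value. The class is only meaningful for
  semiclassical functionals.
\<close>

definition hahn_class :: "complex \<Rightarrow> (complex poly \<Rightarrow> complex) \<Rightarrow> nat" where
  "hahn_class r u =
     (LEAST s. \<exists>\<Phi> \<Psi>. hahn_pair r u \<Phi> \<Psi> \<and> s = max (degree \<Phi> - 2) (degree \<Psi> - 1))"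

definition hahn_semiclassical_OPS :: "complex \<Rightarrow> nat \<Rightarrow> (nat \<Rightarrow> complex poly) \<Rightarrow> bool" where
  "hahn_semiclassical_OPS r s p \<longleftrightarrow>
     (\<exists>u. OPS_wrt u p \<and> hahn_semiclassical r u \<and> hahn_class r u = s)"

definition hahn_classical_OPS :: "complex \<Rightarrow> (nat \<Rightarrow> complex poly) \<Rightarrow> bool" where
  "hahn_classical_OPS r p \<longleftrightarrow> hahn_semiclassical_OPS r 0 p"

end

theory Submission
  imports Defs
begin

text \<open>
  Pushing \<open>u\<close> forward along \<open>x \<mapsto> x\<^sup>k\<close> gives a functional \<open>v f = u (f(x\<^sup>k))\<close> with orthogonal sequence
  \<open>Q\<close>. Expanding \<open>\<phi>\<close> in the basis \<open>p\<close>, only the terms \<open>p (n * k)\<close> pair nontrivially with polynomials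
  in \<open>x\<^sup>k\<close>, so \<open>u (\<phi> h(x\<^sup>k)) = v (\<chi> h)\<close> for some \<open>\<chi>\<close> with \<open>degree \<chi> \<le> degree \<phi> div k\<close>.
  Testing the Pearson equation of \<open>u\<close> on \<open>x\<^sup>j g(x\<^sup>k)\<close> for \<open>j < k\<close> therefore yields a Pearson
  equation for \<open>v\<close> with polynomials of degrees at most 2 and 1. If its first polynomial vanished for
  all \<open>j < k\<close>, then \<open>x\<^sup>k\<^sup>-\<^sup>1 \<Phi> u = 0\<close>, contradicting regularity. A single \<open>j\<close> does not suffice: if
  \<open>u\<close> is symmetric, \<open>\<Phi>\<close> even, \<open>\<Psi>\<close> odd and \<open>k = 2\<close>, then \<open>j = 0\<close> gives only \<open>0 = 0\<close>.
\<close>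

section \<open>Linear functionals and expansion along graded bases\<close>

lemma linear_functional_add:
  assumes "linear_functional u"
  shows "u (f + g) = u f + u g"
  using assms unfolding linear_functional_def
  by (simp add: Vector_Spaces.linear_iff)

lemma linear_functional_smult:
  assumes "linear_functional u"
  shows "u (smult c f) = c * u f"
  using assms unfolding linear_functional_def
  by (simp add: Vector_Spaces.linear_iff)

lemma linear_functional_zero:
  assumes "linear_functional u"
  shows "u 0 = 0"
  using linear_functional_smult[OF assms, of 0 0] by simp

text \<open>Subtracting a multiple of \<open>b M\<close> lowers the degree, so the
  \<open>b n\<close> with n \<le> N span all polynomials of degree at most N, and claims linear in f
  need checking only there. The degree condition alone would still allow \<open>b 0\<close> to
  vanish, hence \<open>nz\<close>.\<close>

lemma graded_basis_induct [consumes 2, case_names zero add smult]: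
  fixes b :: "nat \<Rightarrow> 'a :: field poly"
  assumes "degree f \<le> N" and deg: "\<And>n. degree (b n) = n"
    and zero: "P 0"
    and add: "\<And>f g. P f \<Longrightarrow> P g \<Longrightarrow> P (f + g)"
    and smult: "\<And>c n. n \<le> N \<Longrightarrow> b n \<noteq> 0 \<Longrightarrow> P (smult c (b n))"
    and nz: "b 0 \<noteq> 0"
  shows "P f"
proof -
  have b_nz: "b n \<noteq> 0" for n
    using deg[of n] nz by (cases "n = 0") auto
  have "P f" if "degree f \<le> M" "M \<le> N" for f M
    using that
  proof (induction M arbitrary: f)
    case 0
    obtain a c where "f = [:a:]" "b 0 = [:c:]" "c \<noteq> 0"
      using 0 deg[of 0] nz by (metis degree_eq_zeroE le_zero_eq pCons_0_0)
    then have "f = smult (a / c) (b 0)" by simp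
    then show ?case using smult[of 0] nz by simp
  next
    case (Suc M)
    let ?c = "coeff f (Suc M) / lead_coeff (b (Suc M))"
    let ?g = "f - smult ?c (b (Suc M))"
    have "degree ?g \<le> Suc M"
      using Suc.prems(1) deg by (intro degree_diff_le) auto
    moreover have "coeff ?g (Suc M) = 0"
      using b_nz[of "Suc M"] deg[of "Suc M"] leading_coeff_0_iff[of "b (Suc M)"] by simp
    ultimately have "degree ?g \<le> M"
      using eq_zero_or_degree_less[of ?g "Suc M"] by auto
    then have "P ?g" using Suc by simp
    then have "P (?g + smult ?c (b (Suc M)))"
      using Suc.prems(2) b_nz by (intro add smult)
    then show ?case by simp
  qed
  then show ?thesis using assms(1) by simp
qed

section \<open>Orthogonal sequences\<close>

lemma OPS_wrt_linear: "OPS_wrt u p \<Longrightarrow> linear_functional u"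
  and OPS_wrt_degree: "OPS_wrt u p \<Longrightarrow> degree (p n) = n"
  by (auto simp: OPS_wrt_def)

lemma OPS_wrt_orthogonal: "OPS_wrt u p \<Longrightarrow> n \<noteq> m \<Longrightarrow> u (p n * p m) = 0"
  and OPS_wrt_square: "OPS_wrt u p \<Longrightarrow> u (p n * p n) \<noteq> 0"
  by (auto simp: OPS_wrt_def)

lemma OPS_wrt_nonzero: "OPS_wrt u p \<Longrightarrow> p n \<noteq> 0"
  using OPS_wrt_square[of u p n] linear_functional_zero[OF OPS_wrt_linear] by auto

text \<open>Expand f along p: only the \<open>p n\<close> component pairs with \<open>p n\<close>,
  and since the lower components do not reach x^n, its weight is read off from
  \<open>coeff f n\<close>.\<close>

lemma OPS_wrt_apply_top:
  assumes "OPS_wrt u p" and "degree f \<le> n"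
  shows "u (f * p n) = coeff f n / lead_coeff (p n) * u (p n * p n)"
proof -
  note lin = OPS_wrt_linear[OF assms(1)] and deg = OPS_wrt_degree[OF assms(1)]
  show ?thesis
    using assms(2) deg
  proof (induction f rule: graded_basis_induct)
    case zero
    show ?case by (simp add: linear_functional_zero[OF lin])
  next
    case (add f g)
    then show ?case
      by (simp add: distrib_right linear_functional_add[OF lin] add_divide_distrib)
  next
    case (smult c m)
    show ?case
    proof (cases "m = n")
      case True
      then show ?thesis
        using OPS_wrt_nonzero[OF assms(1), of n] deg[of n] leading_coeff_0_iff[of "p n"]
        by (simp add: linear_functional_smult[OF lin])
    next
      case False
      then have "coeff (p m) n = 0"
        using smult deg[of m] by (intro coeff_eq_0) auto
      then show ?thesis
        using False by (simp add: linear_functional_smult[OF lin] OPS_wrt_orthogonal[OF assms(1)])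
    qed
  qed (rule OPS_wrt_nonzero[OF assms(1)])
qed

text \<open>The tested value is the leading coefficient of \<phi> times a nonzero factor, so this
  single value detects vanishing.\<close>

lemma OPS_wrt_annihilator:
  assumes "OPS_wrt u p" and "u (\<phi> * p (degree \<phi>)) = 0"
  shows "\<phi> = 0"
proof -
  have "coeff \<phi> (degree \<phi>) / lead_coeff (p (degree \<phi>)) = 0"
    using OPS_wrt_apply_top[OF assms(1) order_refl, of \<phi>] assms(2)
      OPS_wrt_square[OF assms(1), of "degree \<phi>"] by simp
  then show ?thesis
    using OPS_wrt_nonzero[OF assms(1), of "degree \<phi>"] by simp
qed

section \<open>Calculus of the Hahn operator\<close>

lemma hahn_op_eqI:
  assumes "r \<noteq> 1" and "[:0, r - 1:] * g = f \<circ>\<^sub>p [:0, r:] - f"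
  shows "hahn_op r f = g"
proof -
  have "[:0, r - 1:] * hahn_op r f = [:0, r - 1:] * g"
    using hahn_op_mult[OF assms(1)] assms(2) by simp
  then show ?thesis using assms(1) mult_cancel_left[of "[:0, r - 1:]"] by (metis pCons_eq_0_iff right_minus_eq)
qed

lemma pcompose_power: "(f ^ n) \<circ>\<^sub>p g = (f \<circ>\<^sub>p g) ^ n" for f g :: "'a :: comm_ring_1 poly"
  by (induction n) (simp_all add: pcompose_mult pcompose_1)

lemma monom_pcompose_scale: "monom 1 n \<circ>\<^sub>p [:0, r:] = (monom (r ^ n) n :: 'a :: comm_ring_1 poly)"
proof -
  have "[:0, r:] ^ n = monom (r ^ n) n"
    using monom_power[of r 1 n] by (simp add: monom_altdef)
  then show ?thesis
    by (simp add: monom_altdef pcompose_power pcompose_pCons)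
qed

lemma hahn_op_monom:
  assumes "r \<noteq> 1"
  shows "hahn_op r (monom 1 n) = monom ((r ^ n - 1) / (r - 1)) (n - 1)"
proof (rule hahn_op_eqI[OF assms])
  have "[:0, r - 1:] = monom (r - 1) 1"
    by (simp add: monom_altdef)
  then show "[:0, r - 1:] * monom ((r ^ n - 1) / (r - 1)) (n - 1) = monom 1 n \<circ>\<^sub>p [:0, r:] - monom 1 n"
    using assms by (cases n) (simp_all del: monom_eq_1 add: mult_monom diff_monom monom_pcompose_scale)
qed

text \<open>Add and subtract f(rx) g(x). Dilating the first factor is the useful choice: for f = x^j
  it only multiplies by r^j and leaves g undilated.\<close>

lemma hahn_op_mult_distrib:
  assumes "r \<noteq> 1"
  shows "hahn_op r (f * g) = f \<circ>\<^sub>p [:0, r:] * hahn_op r g + hahn_op r f * g"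
proof (rule hahn_op_eqI[OF assms])
  have "[:0, r - 1:] * (f \<circ>\<^sub>p [:0, r:] * hahn_op r g + hahn_op r f * g) =
      f \<circ>\<^sub>p [:0, r:] * ([:0, r - 1:] * hahn_op r g) + ([:0, r - 1:] * hahn_op r f) * g"
    by (simp only: algebra_simps)
  also have "\<dots> = (f * g) \<circ>\<^sub>p [:0, r:] - f * g"
    unfolding hahn_op_mult[OF assms] pcompose_mult by (simp add: algebra_simps)
  finally show "[:0, r - 1:] * (f \<circ>\<^sub>p [:0, r:] * hahn_op r g + hahn_op r f * g) =
      (f * g) \<circ>\<^sub>p [:0, r:] - f * g" .
qed

text \<open>Since (r x)^k = r^k x^k, composing with x^k turns dilation by r into dilation by r^k;
  this is the source of the base q^k. The first factor is H_r applied to x^k.\<close>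

lemma hahn_op_pcompose_monom:
  assumes "r \<noteq> 1" and "r ^ k \<noteq> 1"
  shows "hahn_op r (g \<circ>\<^sub>p monom 1 k) =
    monom ((r ^ k - 1) / (r - 1)) (k - 1) * (hahn_op (r ^ k) g \<circ>\<^sub>p monom 1 k)"
proof (rule hahn_op_eqI[OF assms(1)])
  have "k \<noteq> 0" using assms(2) by (cases k) auto
  have "[:0, r - 1:] = monom (r - 1) 1"
    by (simp add: monom_altdef)
  then have *: "[:0, r - 1:] * monom ((r ^ k - 1) / (r - 1)) (k - 1) = monom (r ^ k - 1) k"
    using assms(1) \<open>k \<noteq> 0\<close> by (simp add: mult_monom)
  have "[:0, r ^ k - 1:] \<circ>\<^sub>p monom 1 k = monom (r ^ k - 1) k"
    and "[:0, r ^ k:] \<circ>\<^sub>p monom 1 k = monom (r ^ k) k"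
    by (simp_all add: pcompose_pCons smult_monom mult.commute[of "monom 1 k"])
  then have "monom (r ^ k - 1) k * (hahn_op (r ^ k) g \<circ>\<^sub>p monom 1 k) =
      ([:0, r ^ k - 1:] * hahn_op (r ^ k) g) \<circ>\<^sub>p monom 1 k"
    and 2: "monom 1 k \<circ>\<^sub>p [:0, r:] = [:0, r ^ k:] \<circ>\<^sub>p monom 1 k"
    by (simp_all only: pcompose_mult monom_pcompose_scale)
  then show "[:0, r - 1:] * (monom ((r ^ k - 1) / (r - 1)) (k - 1) * (hahn_op (r ^ k) g \<circ>\<^sub>p monom 1 k)) =
      (g \<circ>\<^sub>p monom 1 k) \<circ>\<^sub>p [:0, r:] - g \<circ>\<^sub>p monom 1 k"
    unfolding mult.assoc[symmetric] * hahn_op_mult[OF assms(2)]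
    by (simp add: pcompose_diff pcompose_assoc[symmetric])
qed

section \<open>Pushing the functional forward along x^k\<close>

lemma pushforward_OPS:
  assumes "OPS_wrt u p" and "k \<ge> 1" and "\<And>n. degree (Q n) = n"
    and "\<And>n. p (n * k) = Q n \<circ>\<^sub>p monom 1 k"
  shows "OPS_wrt (\<lambda>f. u (f \<circ>\<^sub>p monom 1 k)) Q"
proof -
  note lin = OPS_wrt_linear[OF assms(1)]
  have "linear_functional (\<lambda>f. u (f \<circ>\<^sub>p monom 1 k))"
    using lin unfolding linear_functional_def Vector_Spaces.linear_iff
    by (simp add: pcompose_add pcompose_smult)
  moreover obtain \<kappa> where "\<And>n. \<kappa> n \<noteq> 0" "\<And>n m. u (p n * p m) = (if n = m then \<kappa> n else 0)"
    using assms(1) unfolding OPS_wrt_def by blast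
  \<comment> \<open>The value for \<open>Q n\<close> is the one for \<open>p (n * k)\<close>; k
    \<ge> 1 makes n * k = m * k equivalent to n = m.\<close>
  then have "\<exists>\<kappa>. (\<forall>n. \<kappa> n \<noteq> 0) \<and>
      (\<forall>n m. u ((Q n * Q m) \<circ>\<^sub>p monom 1 k) = (if n = m then \<kappa> n else 0))"
    using assms(2) by (intro exI[of _ "\<lambda>n. \<kappa> (n * k)"]) (auto simp: pcompose_mult assms(4)[symmetric])
  ultimately show ?thesis
    using assms(3) unfolding OPS_wrt_def by blast
qed

lemma pushforward_reduce:
  assumes "OPS_wrt u p" and "k \<ge> 1" and "\<And>n. degree (Q n) = n"
    and "\<And>n. p (n * k) = Q n \<circ>\<^sub>p monom 1 k"
    and "degree \<phi> \<le> N"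
  obtains \<chi> where "degree \<chi> \<le> N div k"
    and "\<And>h. u (\<phi> * h \<circ>\<^sub>p monom 1 k) = u ((\<chi> * h) \<circ>\<^sub>p monom 1 k)"
proof -
  note lin = OPS_wrt_linear[OF assms(1)]
  note u_simps = linear_functional_zero[OF lin] linear_functional_add[OF lin]
    linear_functional_smult[OF lin]
  have Q_nz: "Q 0 \<noteq> 0"
    using OPS_wrt_nonzero[OF pushforward_OPS[OF assms(1-4)]] .
  have zero: "u (p n * h \<circ>\<^sub>p monom 1 k) = 0" if "\<not> k dvd n" for n h
    using order_refl[of "degree h"] assms(3)
  proof (induction h rule: graded_basis_induct)
    case (smult c m)
    have "n \<noteq> m * k" using that by auto
    then show ?case
      by (simp add: pcompose_smult u_simps assms(4)[symmetric] OPS_wrt_orthogonal[OF assms(1)])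
  qed (simp_all add: u_simps pcompose_add distrib_left Q_nz)
  have "\<exists>\<chi>. degree \<chi> \<le> N div k \<and>
      (\<forall>h. u (\<phi> * h \<circ>\<^sub>p monom 1 k) = u ((\<chi> * h) \<circ>\<^sub>p monom 1 k))"
    using assms(5) OPS_wrt_degree[OF assms(1)]
  proof (induction \<phi> rule: graded_basis_induct)
    case zero
    show ?case by (intro exI[of _ 0]) simp
  next
    case (add f g)
    then obtain \<chi>1 \<chi>2 where
      "degree \<chi>1 \<le> N div k" "\<And>h. u (f * h \<circ>\<^sub>p monom 1 k) = u ((\<chi>1 * h) \<circ>\<^sub>p monom 1 k)"
      "degree \<chi>2 \<le> N div k" "\<And>h. u (g * h \<circ>\<^sub>p monom 1 k) = u ((\<chi>2 * h) \<circ>\<^sub>p monom 1 k)"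
      by blast
    then show ?case
      by (intro exI[of _ "\<chi>1 + \<chi>2"]) (simp add: degree_add_le distrib_right pcompose_add u_simps)
  next
    case (smult c n)
    show ?case
    proof (cases "k dvd n")
      case True
      then obtain m where "n = m * k" by (metis dvdE mult.commute)
      moreover have "m \<le> N div k"
        using smult \<open>n = m * k\<close> assms(2) by (simp add: less_eq_div_iff_mult_less_eq)
      \<comment> \<open>Here \<open>p n\<close> is \<open>Q m\<close> composed with x^k, so its
        product with h(x^k) is again a polynomial in x^k.\<close>
      ultimately show ?thesis
        by (intro exI[of _ "smult c (Q m)"])
          (auto simp: assms(3,4) pcompose_mult pcompose_smult intro: order_trans[OF degree_smult_le])
    next
      case False
      then show ?thesis
        by (intro exI[of _ 0]) (simp add: zero u_simps)
    qed
  qed (rule OPS_wrt_nonzero[OF assms(1)])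
  then show ?thesis using that by blast
qed

section \<open>Nondegeneracy and Pearson equations\<close>

lemma hahn_op_range_annihilator:
  assumes "OPS_wrt v Q" and "\<And>n. n \<ge> 1 \<Longrightarrow> r ^ n \<noteq> 1"
    and "\<And>g. v (\<phi> * hahn_op r g) = 0"
  shows "\<phi> = 0"
proof -
  note lin = OPS_wrt_linear[OF assms(1)]
  have r: "r \<noteq> 1" using assms(2)[of 1] by simp
  \<comment> \<open>The index shift makes \<open>b n\<close> a multiple of x^n, nonzero because
    r^(n+1) \<noteq> 1; so the range of H_r contains a graded basis.\<close>
  define b where "b n = hahn_op r (monom 1 (Suc n))" for n
  have b: "b n = monom ((r ^ Suc n - 1) / (r - 1)) n" for n
    unfolding b_def hahn_op_monom[OF r] by simp
  have b_deg: "degree (b n) = n" for n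
    using assms(2)[of "Suc n"] r unfolding b by (subst degree_monom_eq) auto
  have "v (\<phi> * f) = 0" for f
    using order_refl[of "degree f"] b_deg
  proof (induction f rule: graded_basis_induct)
    case (smult c n)
    then show ?case
      by (simp add: linear_functional_smult[OF lin] b_def assms(3))
  qed (use r in \<open>simp_all add: linear_functional_zero[OF lin] linear_functional_add[OF lin]
      distrib_left b monom_eq_0_iff\<close>)
  then show ?thesis
    by (intro OPS_wrt_annihilator[OF assms(1)])
qed

lemma hahn_op_degree_0:
  assumes "degree g = 0"
  shows "hahn_op r g = 0"
proof -
  obtain c where "g = [:c:]" using assms by (rule degree_eq_zeroE)
  then show ?thesis by (simp add: hahn_op_def)
qed

text \<open>The degree bound on \<Psi> is automatic: if \<Psi> were constant, testing on the
  constant \<open>Q 0\<close>, which H_r kills, would give \<Psi> = 0, hence H_r(\<Phi> v) = 0 and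
  \<Phi> = 0.\<close>

lemma hahn_pairI:
  assumes "OPS_wrt v Q" and "\<And>n. n \<ge> 1 \<Longrightarrow> r ^ n \<noteq> 1" and "\<Phi> \<noteq> 0"
    and eq: "\<And>g. - v (\<Phi> * hahn_op r g) = v (\<Psi> * g)"
  shows "hahn_pair r v \<Phi> \<Psi>"
proof -
  have "degree \<Psi> \<ge> 1"
  proof (rule ccontr)
    assume "\<not> degree \<Psi> \<ge> 1"
    then have deg: "degree \<Psi> = 0" by simp
    have "hahn_op r (Q 0) = 0"
      by (rule hahn_op_degree_0) (rule OPS_wrt_degree[OF assms(1)])
    then have "v (\<Psi> * Q (degree \<Psi>)) = 0"
      using eq[of "Q 0"] deg linear_functional_zero[OF OPS_wrt_linear[OF assms(1)]] by simp
    then have "\<Psi> = 0"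
      by (rule OPS_wrt_annihilator[OF assms(1)])
    then have "v (\<Phi> * hahn_op r g) = 0" for g
      using eq[of g] linear_functional_zero[OF OPS_wrt_linear[OF assms(1)]] by simp
    then show False
      using hahn_op_range_annihilator[OF assms(1,2)] assms(3) by blast
  qed
  then show ?thesis
    using assms(3) eq by (auto simp: hahn_pair_def hahn_functional_def poly_times_functional_def)
qed

text \<open>Writing x^n = x^(n mod k) (x^k)^(n div k) shows that the test polynomials span
  everything.\<close>

lemma residue_class_annihilator:
  assumes "OPS_wrt u p" and "k \<ge> 1"
    and "\<And>j h. j < k \<Longrightarrow> u (\<phi> * (monom 1 j * h \<circ>\<^sub>p monom 1 k)) = 0"
  shows "\<phi> = 0"
proof -
  note lin = OPS_wrt_linear[OF assms(1)]
  have "u (\<phi> * f) = 0" for f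
    using order_refl[of "degree f"] degree_monom_eq[OF one_neq_zero]
  proof (induction f rule: graded_basis_induct)
    case (smult c n)
    have "monom 1 (n div k) \<circ>\<^sub>p monom 1 k = (monom 1 k ^ (n div k) :: complex poly)"
      by (simp add: monom_altdef pcompose_power pcompose_pCons)
    then have "monom 1 n = monom 1 (n mod k) * (monom 1 (n div k) \<circ>\<^sub>p monom 1 k :: complex poly)"
      by (simp add: monom_power mult_monom)
    then show ?case
      using assms(2) by (simp add: linear_functional_smult[OF lin] assms(3))
  qed (simp_all add: linear_functional_zero[OF lin] linear_functional_add[OF lin]
      distrib_left)
  then show ?thesis
    by (intro OPS_wrt_annihilator[OF assms(1)])
qed

text \<open>Test the Pearson equation on x^j g(x^k), apply the product and chain rules, and separate
  the terms with g from those with its Hahn derivative. For j = 0 the truncated \<open>j - 1\<close>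
  is harmless, as its coefficient vanishes.\<close>

lemma hahn_pair_apply_residue_class:
  assumes "hahn_pair r u \<Phi> \<Psi>" and "linear_functional u" and "r \<noteq> 1" and "r ^ k \<noteq> 1"
  shows "- u (smult (r ^ j * ((r ^ k - 1) / (r - 1))) (\<Phi> * monom 1 (j + (k - 1))) *
        hahn_op (r ^ k) g \<circ>\<^sub>p monom 1 k) =
    u ((\<Psi> * monom 1 j + smult ((r ^ j - 1) / (r - 1)) (\<Phi> * monom 1 (j - 1))) * g \<circ>\<^sub>p monom 1 k)"
    (is "- u (?A * ?Hg) = u ((_ + ?B) * ?g)")
proof -
  have "- u (\<Phi> * hahn_op r (monom 1 j * ?g)) = u (\<Psi> * (monom 1 j * ?g))"
    using assms(1) unfolding hahn_pair_def hahn_functional_def poly_times_functional_def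
    by metis
  moreover have "\<Phi> * hahn_op r (monom 1 j * ?g) = ?A * ?Hg + ?B * ?g"
  proof -
    have 1: "monom a n = smult a (monom 1 n)" for a :: complex and n
      by (simp add: smult_monom)
    have 2: "monom 1 (j + (k - 1)) = monom 1 j * (monom 1 (k - 1) :: complex poly)"
      by (simp add: mult_monom)
    show ?thesis
      unfolding hahn_op_mult_distrib[OF assms(3)] monom_pcompose_scale hahn_op_monom[OF assms(3)]
        hahn_op_pcompose_monom[OF assms(3,4)] 1[of "r ^ j"] 1[of "_ / _"] 2
      by (simp add: algebra_simps)
  qed
  ultimately have "u (\<Psi> * monom 1 j * ?g) = - (u (?A * ?Hg) + u (?B * ?g))"
    by (simp only: linear_functional_add[OF assms(2)] mult.assoc[of \<Psi>])
  then show ?thesis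
    unfolding distrib_right linear_functional_add[OF assms(2)] by (simp only:) simp
qed

theorem corollary3p6:
  fixes k s :: nat and q :: complex and p Q :: "nat \<Rightarrow> complex poly"
  assumes "k \<ge> 2"
    and "q \<noteq> 0" and "\<forall>n::nat. n \<ge> 1 \<longrightarrow> q ^ n \<noteq> 1"
    and "monic_OPS p" and "monic_OPS Q"
    and "\<forall>n. p (n * k) = Q n \<circ>\<^sub>p monom 1 k"
    and "hahn_semiclassical_OPS q s p" and "s \<le> k - 1"
  shows "hahn_classical_OPS (q ^ k) Q"
proof -
  obtain u where u: "OPS_wrt u p" and "hahn_semiclassical q u" and "hahn_class q u = s"
    using assms(7) unfolding hahn_semiclassical_OPS_def by blast
  then obtain \<Phi> \<Psi> where pair: "hahn_pair q u \<Phi> \<Psi>" and "s = max (degree \<Phi> - 2) (degree \<Psi> - 1)"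
    using LeastI_ex[of "\<lambda>s. \<exists>\<Phi> \<Psi>. hahn_pair q u \<Phi> \<Psi> \<and> s = max (degree \<Phi> - 2) (degree \<Psi> - 1)"]
    unfolding hahn_class_def hahn_semiclassical_def by blast
  \<comment> \<open>The chosen pair attains the class, so s \<le> k - 1 bounds both degrees.\<close>
  then have deg: "degree \<Phi> \<le> k + 1" "degree \<Psi> \<le> k"
    using assms(1,8) by auto
  have k: "k \<ge> 1" using assms(1) by simp
  have q1: "q \<noteq> 1" "q ^ k \<noteq> 1" and qk: "\<And>n. n \<ge> 1 \<Longrightarrow> (q ^ k) ^ n \<noteq> 1"
    using assms(3)[rule_format, of 1] assms(3)[rule_format, of k]
      assms(3)[rule_format, of "k * n" for n] k by (auto simp: power_mult[symmetric])
  have Q_deg: "degree (Q n) = n" for n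
    using assms(5) by (auto simp: monic_OPS_def OPS_def OPS_wrt_def)
  define v where "v f = u (f \<circ>\<^sub>p monom 1 k)" for f
  have v: "OPS_wrt v Q"
    using pushforward_OPS[OF u k Q_deg] assms(6) unfolding v_def by simp
  have reduce: "\<exists>\<chi>. degree \<chi> \<le> N div k \<and> (\<forall>h. u (\<phi> * h \<circ>\<^sub>p monom 1 k) = v (\<chi> * h))"
    if "degree \<phi> \<le> N" for \<phi> N
    using pushforward_reduce[OF u k Q_deg _ that] assms(6) unfolding v_def by metis
  \<comment> \<open>The chain rule contributes x^(k-1) to the factor of the Hahn derivative; j is
    chosen so that this factor survives the reduction to v.\<close>
  have "\<Phi> * monom 1 (k - 1) \<noteq> 0"
    using pair by (simp add: hahn_pair_def)
  then obtain j h0 where j: "j < k"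
    and nz: "u (\<Phi> * monom 1 (k - 1) * (monom 1 j * h0 \<circ>\<^sub>p monom 1 k)) \<noteq> 0"
    using residue_class_annihilator[OF u k] by blast
  define A where "A = smult (q ^ j * ((q ^ k - 1) / (q - 1))) (\<Phi> * monom 1 (j + (k - 1)))"
  define B where "B = \<Psi> * monom 1 j + smult ((q ^ j - 1) / (q - 1)) (\<Phi> * monom 1 (j - 1))"
  \<comment> \<open>The degrees add up to (k + 1) + j + (k - 1); as j < k, division by k leaves
    2.\<close>
  have "degree A \<le> 2 * k + j"
    unfolding A_def using deg k
    by (intro order_trans[OF degree_smult_le] order_trans[OF degree_mult_le])
      (simp add: degree_monom_eq)
  then obtain \<Phi>' where "degree \<Phi>' \<le> (2 * k + j) div k"
    and \<Phi>': "\<And>h. u (A * h \<circ>\<^sub>p monom 1 k) = v (\<Phi>' * h)"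
    using reduce by blast
  then have deg_\<Phi>': "degree \<Phi>' \<le> 2" using j by simp
  \<comment> \<open>At j = 0 the truncated exponent would only give k + 1, but then the \<Phi> term
    has coefficient 0. Otherwise its degree is at most (k + 1) + (j - 1).\<close>
  have "degree B \<le> k + j"
  proof (cases "j = 0")
    case True
    then show ?thesis using deg(2) by (simp add: B_def)
  next
    case False
    then show ?thesis
      unfolding B_def using deg
      by (intro degree_add_le order_trans[OF degree_smult_le] order_trans[OF degree_mult_le])
        (simp_all add: degree_monom_eq)
  qed
  then obtain \<Psi>' where "degree \<Psi>' \<le> (k + j) div k"
    and \<Psi>': "\<And>h. u (B * h \<circ>\<^sub>p monom 1 k) = v (\<Psi>' * h)"
    using reduce by blast
  then have deg_\<Psi>': "degree \<Psi>' \<le> 1" using j by simp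
  \<comment> \<open>\<open>h0\<close> witnesses this: \<open>A\<close> is \<Phi> x^(k-1) x^j times a
    scalar that is nonzero because q \<noteq> 0 and q^k \<noteq> 1.\<close>
  have "\<Phi>' \<noteq> 0"
  proof
    assume "\<Phi>' = 0"
    then have "u (A * h0 \<circ>\<^sub>p monom 1 k) = 0"
      using \<Phi>' linear_functional_zero[OF OPS_wrt_linear[OF v]] by simp
    moreover have "A * h0 \<circ>\<^sub>p monom 1 k = smult (q ^ j * ((q ^ k - 1) / (q - 1)))
        (\<Phi> * monom 1 (k - 1) * (monom 1 j * h0 \<circ>\<^sub>p monom 1 k))"
      using mult_monom[of "1::complex" j 1 "k - 1", symmetric] by (simp add: A_def mult_ac)
    ultimately show False
      using nz q1 assms(2) by (simp add: linear_functional_smult[OF OPS_wrt_linear[OF u]])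
  qed
  moreover have "- v (\<Phi>' * hahn_op (q ^ k) g) = v (\<Psi>' * g)" for g
    using hahn_pair_apply_residue_class[OF pair OPS_wrt_linear[OF u] q1, of j g]
    unfolding A_def[symmetric] B_def[symmetric] \<Phi>' \<Psi>' .
  ultimately have pair': "hahn_pair (q ^ k) v \<Phi>' \<Psi>'"
    by (intro hahn_pairI[OF v qk])
  moreover have "max (degree \<Phi>' - 2) (degree \<Psi>' - 1) = 0"
    using deg_\<Phi>' deg_\<Psi>' by simp
  ultimately have "hahn_class (q ^ k) v = 0"
    unfolding hahn_class_def by (intro Least_eq_0) metis
  then show ?thesis
    using v pair' unfolding hahn_classical_OPS_def hahn_semiclassical_OPS_def
      hahn_semiclassical_def regular_functional_def by blast
qed

end
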